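(* Let $\gamma\in\mathcal{N}_G\cap\mathcal{N}_L$ be semisimple and suppose $v\in V$ satisfies $\gamma v=\zeta v$ for some $\zeta\in K^\times$. Let $\bar v=\pi(v)\in E$ and write $\bar v=\bar v_1\oplus\bar v_2\oplus\cdots$ with $\bar v_i\in E_i$. Then for each $i$, $\bar\gamma_i(\bar v_i)=\zeta^i\bar v_i$, where $\bar\gamma_i$ is the image of $\gamma$ in $\mathrm{GL}(E_i)$.
   Context: Let $K$ be an algebraically closed field of characteristic $0$, $V$ a finite-dimensional $K$-vector space, $G\subset\mathrm{GL}(V)$ a finite group generated by (pseudo)reflections and $L$ a normal subgroup of $G$. Let $S$ be the graded algebra of polynomial functions on $V$, with $\mathrm{GL}(V)$ acting by $(gf)(v)=f(g^{-1}v)$; $A_+$ denotes the positive-degree part of a graded algebra $A$. Let $\mathcal{N}_G,\mathcal{N}_L$ be the normalisers of $G$, $L$ in $\mathrm{GL}(V)$. Let $E^*$ be an $\mathcal{N}_L$-stable graded complement to $(S^L_+)^2$ in $S^L_+$, and $E=\oplus_i E_i$ its graded dual, where $E_i$ is dual to the degree-$i$ part of $E^*$. Let $(Q_1,\dots,Q_s)$ be a homogeneous basis of $E^*$ with dual basis $(e_1,\dots,e_s)$ of $E$, and let $\pi:V\to E$, $\pi(v)=\sum_j Q_j(v)e_j$ (this factors through a closed embedding $V/L\hookrightarrow E$). $\bar G=G/L$ acts on $E$; assume it acts as a group generated by reflections. *)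

theory Defs
  imports "HOL-Analysis.Analysis"
begin

text \<open>Setting: K = type 'k (field of characteristic 0, algebraically closed by hypothesis),
V = 'k^'n, GL(V) = invertible matrices, acting on V by matrix-vector multiplication.\<close>

definition alg_closed_field :: "'k::field itself \<Rightarrow> bool" where
  "alg_closed_field _ \<longleftrightarrow> (\<forall>p::'k poly. degree p \<ge> 1 \<longrightarrow> (\<exists>x. poly p x = 0))"

text \<open>Generic generated submonoid (for finite groups this is the generated subgroup).\<close>
inductive_set generated :: "('a \<Rightarrow> 'a \<Rightarrow> 'a) \<Rightarrow> 'a \<Rightarrow> 'a set \<Rightarrow> 'a set"
  for mult :: "'a \<Rightarrow> 'a \<Rightarrow> 'a" and one :: 'a and R :: "'a set" where
  gen_one: "one \<in> generated mult one R"
| gen_mult: "x \<in> R \<Longrightarrow> y \<in> generated mult one R \<Longrightarrow> mult x y \<in> generated mult one R"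

text \<open>Finite subgroups of GL(V).\<close>
definition finite_matrix_group :: "('k::field^'n^'n) set \<Rightarrow> bool" where
  "finite_matrix_group G \<longleftrightarrow> finite G \<and> mat 1 \<in> G \<and> (\<forall>g\<in>G. invertible g) \<and>
     (\<forall>g\<in>G. \<forall>h\<in>G. g ** h \<in> G) \<and> (\<forall>g\<in>G. matrix_inv g \<in> G)"

text \<open>Pseudo-reflection on V: g \<noteq> 1 and g - 1 has rank one.\<close>
definition pseudo_reflection :: "'k::field^'n^'n \<Rightarrow> bool" where
  "pseudo_reflection g \<longleftrightarrow> invertible g \<and> g \<noteq> mat 1 \<and>
     (\<exists>a b::'k^'n. \<forall>v. g *v v = v + (\<Sum>i\<in>UNIV. b$i * v$i) *s a)"

definition reflection_group :: "('k::field^'n^'n) set \<Rightarrow> bool" where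
  "reflection_group G \<longleftrightarrow> finite_matrix_group G \<and>
     G = generated (**) (mat 1) {g\<in>G. pseudo_reflection g}"

definition normal_subgroup :: "('k::field^'n^'n) set \<Rightarrow> ('k^'n^'n) set \<Rightarrow> bool" where
  "normal_subgroup L G \<longleftrightarrow> finite_matrix_group L \<and> L \<subseteq> G \<and>
     (\<forall>g\<in>G. \<forall>l\<in>L. g ** l ** matrix_inv g \<in> L)"

text \<open>Normaliser of a set of matrices in GL(V).\<close>
definition normaliser :: "('k::field^'n^'n) set \<Rightarrow> ('k^'n^'n) set" where
  "normaliser G = {\<gamma>. invertible \<gamma> \<and> (\<lambda>g. \<gamma> ** g ** matrix_inv \<gamma>) ` G = G}"

text \<open>Semisimple = diagonalisable (K algebraically closed).\<close>
definition semisimple :: "'k::field^'n^'n \<Rightarrow> bool" where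
  "semisimple \<gamma> \<longleftrightarrow> (\<exists>P::'k^'n^'n. invertible P \<and>
     (\<forall>i j. i \<noteq> j \<longrightarrow> (P ** \<gamma> ** matrix_inv P) $ i $ j = 0))"

text \<open>Linear span (over 'k) of a set of 'k-valued functions.\<close>
definition spanK :: "('a \<Rightarrow> 'k::field) set \<Rightarrow> ('a \<Rightarrow> 'k) set" where
  "spanK A = {f. \<exists>B c. finite B \<and> B \<subseteq> A \<and> f = (\<lambda>x. \<Sum>b\<in>B. c b * b x)}"

text \<open>Polynomial functions on V: S, and its homogeneous parts S_d.\<close>
definition monomial_fn :: "('n::finite \<Rightarrow> nat) \<Rightarrow> 'k::field^'n \<Rightarrow> 'k" where
  "monomial_fn \<alpha> v = (\<Prod>i\<in>UNIV. (v$i) ^ \<alpha> i)"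

definition polyfns :: "('k::field^'n::finite \<Rightarrow> 'k) set" where
  "polyfns = spanK (range monomial_fn)"

definition hom_polyfns :: "nat \<Rightarrow> ('k::field^'n::finite \<Rightarrow> 'k) set" where
  "hom_polyfns d = spanK {monomial_fn \<alpha> | \<alpha>. (\<Sum>i\<in>UNIV. \<alpha> i) = d}"

text \<open>Action (g f)(v) = f(g^{-1} v).\<close>
definition act :: "'k::field^'n^'n \<Rightarrow> ('k^'n \<Rightarrow> 'k) \<Rightarrow> ('k^'n \<Rightarrow> 'k)" where
  "act g f = (\<lambda>v. f (matrix_inv g *v v))"

definition invariants :: "('k::field^'n::finite^'n) set \<Rightarrow> ('k^'n \<Rightarrow> 'k) set" where
  "invariants L = {f\<in>polyfns. \<forall>g\<in>L. act g f = f}"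

text \<open>Positive-degree part S^L_+ and its square (S^L_+)^2.\<close>
definition inv_plus :: "('k::field^'n::finite^'n) set \<Rightarrow> ('k^'n \<Rightarrow> 'k) set" where
  "inv_plus L = spanK (\<Union>d\<in>{d. d > 0}. hom_polyfns d \<inter> invariants L)"

definition inv_plus_sq :: "('k::field^'n::finite^'n) set \<Rightarrow> ('k^'n \<Rightarrow> 'k) set" where
  "inv_plus_sq L = spanK {(\<lambda>x. f x * g x) | f g. f \<in> inv_plus L \<and> g \<in> inv_plus L}"

definition subspaceK :: "('a \<Rightarrow> 'k::field) set \<Rightarrow> bool" where
  "subspaceK W \<longleftrightarrow> (\<lambda>x. 0) \<in> W \<and> (\<forall>f\<in>W. \<forall>g\<in>W. \<forall>a b. (\<lambda>x. a * f x + b * g x) \<in> W)"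

text \<open>E* is an N_L-stable graded complement to (S^L_+)^2 in S^L_+.\<close>
definition graded_complement :: "('k::field^'n::finite^'n) set \<Rightarrow> ('k^'n \<Rightarrow> 'k) set \<Rightarrow> bool" where
  "graded_complement L Es \<longleftrightarrow> subspaceK Es \<and> Es \<subseteq> inv_plus L \<and>
     Es \<subseteq> spanK (\<Union>d. Es \<inter> hom_polyfns d) \<and>
     Es \<inter> inv_plus_sq L = {\<lambda>x. 0} \<and>
     inv_plus L = {(\<lambda>x. f x + g x) | f g. f \<in> Es \<and> g \<in> inv_plus_sq L}"

text \<open>The (graded) dual E of E*: linear functionals on E*, extended by 0 outside E*.\<close>
definition dualsp :: "('a \<Rightarrow> 'k::field) set \<Rightarrow> (('a \<Rightarrow> 'k) \<Rightarrow> 'k) set" where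
  "dualsp Es = {\<phi>. (\<forall>f. f \<notin> Es \<longrightarrow> \<phi> f = 0) \<and>
     (\<forall>f\<in>Es. \<forall>g\<in>Es. \<forall>a b. \<phi> (\<lambda>x. a * f x + b * g x) = a * \<phi> f + b * \<phi> g)}"

text \<open>E_i: the part of E dual to the degree-i part of E* (kills the other degrees).\<close>
definition dual_part :: "('k::field^'n::finite \<Rightarrow> 'k) set \<Rightarrow> nat \<Rightarrow> (('k^'n \<Rightarrow> 'k) \<Rightarrow> 'k) set" where
  "dual_part Es i = {\<phi>\<in>dualsp Es. \<forall>d f. d \<noteq> i \<longrightarrow> f \<in> Es \<inter> hom_polyfns d \<longrightarrow> \<phi> f = 0}"

text \<open>Contragredient action of \<gamma> on E: (\<gamma> \<phi>)(Q) = \<phi>(\<gamma>^{-1} Q).\<close>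
definition dual_act :: "('k::field^'n::finite \<Rightarrow> 'k) set \<Rightarrow> 'k^'n^'n \<Rightarrow> (('k^'n \<Rightarrow> 'k) \<Rightarrow> 'k) \<Rightarrow> (('k^'n \<Rightarrow> 'k) \<Rightarrow> 'k)" where
  "dual_act Es \<gamma> \<phi> = (\<lambda>f. if f \<in> Es then \<phi> (act (matrix_inv \<gamma>) f) else 0)"

text \<open>Pseudo-reflections of E (linear maps \<rho> with \<rho> - 1 of rank one).\<close>
definition dual_reflection :: "('a \<Rightarrow> 'k::field) set \<Rightarrow> ((('a \<Rightarrow> 'k) \<Rightarrow> 'k) \<Rightarrow> (('a \<Rightarrow> 'k) \<Rightarrow> 'k)) \<Rightarrow> bool" where
  "dual_reflection Es \<rho> \<longleftrightarrow> (\<exists>\<phi>\<in>dualsp Es. \<rho> \<phi> \<noteq> \<phi>) \<and>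
     (\<exists>a\<in>dualsp Es. \<exists>\<alpha>.
        (\<forall>\<phi>\<in>dualsp Es. \<forall>\<psi>\<in>dualsp Es. \<forall>s t. \<alpha> (\<lambda>f. s * \<phi> f + t * \<psi> f) = s * \<alpha> \<phi> + t * \<alpha> \<psi>) \<and>
        (\<forall>\<phi>\<in>dualsp Es. \<rho> \<phi> = (\<lambda>f. \<phi> f + \<alpha> \<phi> * a f)))"

text \<open>G/L acts on E as a group generated by reflections.\<close>
definition quotient_acts_as_reflection_group ::
  "('k::field^'n::finite^'n) set \<Rightarrow> ('k^'n \<Rightarrow> 'k) set \<Rightarrow> bool" where
  "quotient_acts_as_reflection_group G Es \<longleftrightarrow>
    (let H = (\<lambda>\<gamma>. restrict (dual_act Es \<gamma>) (dualsp Es)) ` G in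
     H = generated (\<lambda>x y. compose (dualsp Es) x y) (restrict id (dualsp Es))
            {\<rho>\<in>H. dual_reflection Es \<rho>})"

end

theory Submission
  imports Defs "HOL-Library.Function_Algebras"
begin

text \<open>The components v_i of pi(v) (the w i of the statement) add up to evaluation at v
on E*, and v_i kills the homogeneous elements of E* of degree other than i; so a homogeneous Q
in E* of degree d has v_i(Q) = Q(v) if d = i and v_i(Q) = 0 otherwise. As gamma normalises L,
E* is stable under Q |-> Q o gamma, which preserves degrees; hence (gamma v_i)(Q) = v_i(Q o gamma)
is Q(gamma v) = Q(zeta v) = zeta^d Q(v) if d = i and 0 otherwise, i.e. zeta^i v_i(Q). Both sides
are linear functionals on E*, which is spanned by its homogeneous elements.\<close>

interpretation fun_module: module "\<lambda>(c::'k::field) (f::'a \<Rightarrow> 'k) x. c * f x"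
  by unfold_locales (auto simp: fun_eq_iff algebra_simps)

lemma sum_fun_apply: "(\<Sum>b\<in>B. f b) x = (\<Sum>b\<in>B. f b x)"
  by (induction B rule: infinite_finite_induct) auto

lemma spanK_eq_span: "spanK A = fun_module.span A"
  unfolding spanK_def fun_module.span_explicit by (auto simp: fun_eq_iff sum_fun_apply)

lemma spanK_superset: "a \<in> A \<Longrightarrow> a \<in> spanK A"
  by (simp add: spanK_eq_span fun_module.span_base)

lemma spanK_sum:
  assumes "finite K" and "\<forall>k\<in>K. h k \<in> spanK A"
  shows "(\<lambda>x. \<Sum>k\<in>K. c k * h k x) \<in> spanK A"
proof -
  have "(\<Sum>k\<in>K. (\<lambda>x. c k * h k x)) \<in> fun_module.span A"
    using assms by (intro fun_module.span_sum fun_module.span_scale) (auto simp: spanK_eq_span)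
  moreover have "(\<Sum>k\<in>K. (\<lambda>x. c k * h k x)) = (\<lambda>x. \<Sum>k\<in>K. c k * h k x)"
    by (simp add: fun_eq_iff sum_fun_apply)
  ultimately show ?thesis
    by (simp add: spanK_eq_span)
qed

lemma spanK_mult:
  assumes "f \<in> spanK A" and "g \<in> spanK B"
    and "\<And>a b. a \<in> A \<Longrightarrow> b \<in> B \<Longrightarrow> (\<lambda>x. a x * b x) \<in> spanK C"
  shows "(\<lambda>x. f x * g x) \<in> spanK C"
proof -
  obtain A' c where A': "finite A'" "A' \<subseteq> A" "f = (\<lambda>x. \<Sum>a\<in>A'. c a * a x)"
    using assms(1) unfolding spanK_def by blast
  obtain B' d where B': "finite B'" "B' \<subseteq> B" "g = (\<lambda>x. \<Sum>b\<in>B'. d b * b x)"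
    using assms(2) unfolding spanK_def by blast
  have "(\<lambda>x. a x * g x) \<in> spanK C" if "a \<in> A'" for a
  proof -
    have "(\<lambda>x. \<Sum>b\<in>B'. d b * (a x * b x)) \<in> spanK C"
      using A'(2) B' that assms(3) by (intro spanK_sum) auto
    then show ?thesis
      unfolding B'(3) by (simp add: sum_distrib_left mult.left_commute)
  qed
  then have "(\<lambda>x. \<Sum>a\<in>A'. c a * (a x * g x)) \<in> spanK C"
    using A'(1) by (intro spanK_sum) auto
  then show ?thesis
    unfolding A'(3) by (simp add: sum_distrib_right mult.assoc)
qed

lemma monomial_fn_mult: "monomial_fn \<alpha> x * monomial_fn \<beta> x = monomial_fn (\<lambda>i. \<alpha> i + \<beta> i) x"
  unfolding monomial_fn_def by (simp add: power_add prod.distrib)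

lemma monomial_fn_in_hom_polyfns: "monomial_fn \<alpha> \<in> hom_polyfns (\<Sum>i\<in>UNIV. \<alpha> i)"
  unfolding hom_polyfns_def by (rule spanK_superset) blast

lemma hom_polyfns_sum:
  "finite K \<Longrightarrow> \<forall>k\<in>K. h k \<in> hom_polyfns d \<Longrightarrow> (\<lambda>x. \<Sum>k\<in>K. c k * h k x) \<in> hom_polyfns d"
  unfolding hom_polyfns_def by (rule spanK_sum)

lemma hom_polyfns_mult:
  fixes f g :: "'k::field^'n::finite \<Rightarrow> 'k"
  assumes "f \<in> hom_polyfns d1" and "g \<in> hom_polyfns d2"
  shows "(\<lambda>x. f x * g x) \<in> hom_polyfns (d1 + d2)"
  using assms unfolding hom_polyfns_def
proof (rule spanK_mult)
  fix a b :: "'k^'n \<Rightarrow> 'k"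
  assume "a \<in> {monomial_fn \<alpha> |\<alpha>. (\<Sum>i\<in>UNIV. \<alpha> i) = d1}"
    and "b \<in> {monomial_fn \<alpha> |\<alpha>. (\<Sum>i\<in>UNIV. \<alpha> i) = d2}"
  then obtain \<alpha> \<beta> :: "'n \<Rightarrow> nat" where "a = monomial_fn \<alpha>" "b = monomial_fn \<beta>"
    and "(\<Sum>i\<in>UNIV. \<alpha> i + \<beta> i) = d1 + d2"
    by (auto simp: sum.distrib)
  then show "(\<lambda>x. a x * b x) \<in> spanK {monomial_fn \<alpha> |\<alpha>. (\<Sum>i\<in>UNIV. \<alpha> i) = d1 + d2}"
    using monomial_fn_in_hom_polyfns[of "\<lambda>i. \<alpha> i + \<beta> i"]
    by (simp add: monomial_fn_mult hom_polyfns_def)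
qed

lemma hom_polyfns_prod:
  fixes f :: "'i \<Rightarrow> 'k::field^'n::finite \<Rightarrow> 'k"
  assumes "finite I" and "\<forall>i\<in>I. f i \<in> hom_polyfns (\<delta> i)"
  shows "(\<lambda>x. \<Prod>i\<in>I. f i x) \<in> hom_polyfns (\<Sum>i\<in>I. \<delta> i)"
  using assms
proof (induction I rule: finite_induct)
  case empty
  have "(\<lambda>x::'k^'n. 1) = monomial_fn (\<lambda>_. 0)"
    by (simp add: monomial_fn_def fun_eq_iff)
  also have "\<dots> \<in> hom_polyfns (\<Sum>i\<in>(UNIV::'n set). 0)"
    by (rule monomial_fn_in_hom_polyfns)
  finally show ?case
    by simp
next
  case (insert i I)
  then show ?case
    using hom_polyfns_mult[of "f i" "\<delta> i"] by simp
qed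

lemma hom_polyfns_power:
  assumes "f \<in> hom_polyfns d"
  shows "(\<lambda>x. f x ^ n) \<in> hom_polyfns (n * d)"
  using hom_polyfns_prod[of "{..<n}" "\<lambda>_. f" "\<lambda>_. d"] assms by simp

lemma linear_form_in_hom_polyfns: "(\<lambda>x::'k::field^'n. \<Sum>j\<in>UNIV. a j * x $ j) \<in> hom_polyfns 1"
proof -
  have "(\<lambda>x::'k^'n. x $ j) \<in> hom_polyfns 1" for j
  proof -
    have "(\<lambda>x::'k^'n. x $ j) = monomial_fn (\<lambda>i. if i = j then 1 else 0)"
      by (simp add: monomial_fn_def fun_eq_iff if_distrib cong: if_cong)
    also have "\<dots> \<in> hom_polyfns (\<Sum>i\<in>UNIV. if i = j then 1 else 0)"
      by (rule monomial_fn_in_hom_polyfns)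
    finally show ?thesis
      by simp
  qed
  then show ?thesis
    by (intro hom_polyfns_sum) auto
qed

lemma hom_polyfns_compose_matrix:
  fixes M :: "'k::field^'n::finite^'n"
  assumes "f \<in> hom_polyfns d"
  shows "(\<lambda>x. f (M *v x)) \<in> hom_polyfns d"
proof -
  obtain B c where B: "finite B" "B \<subseteq> {monomial_fn \<alpha> |\<alpha>. (\<Sum>i\<in>UNIV. \<alpha> i) = d}"
    and f: "f = (\<lambda>x. \<Sum>b\<in>B. c b * b x)"
    using assms unfolding hom_polyfns_def spanK_def by blast
  have "(\<lambda>x. b (M *v x)) \<in> hom_polyfns d" if "b \<in> B" for b
  proof -
    obtain \<alpha> where \<alpha>: "b = monomial_fn \<alpha>" "(\<Sum>i\<in>UNIV. \<alpha> i) = d"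
      using B(2) \<open>b \<in> B\<close> by blast
    have "(\<lambda>x. \<Prod>i\<in>UNIV. (\<Sum>j\<in>UNIV. M $ i $ j * x $ j) ^ \<alpha> i)
        \<in> hom_polyfns (\<Sum>i\<in>UNIV. \<alpha> i * 1)"
      by (intro hom_polyfns_prod hom_polyfns_power ballI linear_form_in_hom_polyfns) simp
    then show ?thesis
      by (simp add: \<alpha> monomial_fn_def matrix_vector_mult_def)
  qed
  then show ?thesis
    unfolding f using hom_polyfns_sum[OF B(1), of "\<lambda>b x. b (M *v x)" d c] by simp
qed

lemma hom_polyfns_scale:
  assumes "f \<in> hom_polyfns d"
  shows "f (t *s x) = t ^ d * f x"
proof -
  obtain B c where B: "B \<subseteq> {monomial_fn \<alpha> |\<alpha>. (\<Sum>i\<in>UNIV. \<alpha> i) = d}"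
    and f: "f = (\<lambda>x. \<Sum>b\<in>B. c b * b x)"
    using assms unfolding hom_polyfns_def spanK_def by blast
  have "b (t *s x) = t ^ d * b x" if "b \<in> B" for b
  proof -
    obtain \<alpha> where "b = monomial_fn \<alpha>" "(\<Sum>i\<in>UNIV. \<alpha> i) = d"
      using B \<open>b \<in> B\<close> by blast
    then show ?thesis
      by (auto simp: monomial_fn_def power_mult_distrib prod.distrib power_sum)
  qed
  then show ?thesis
    by (simp add: f sum_distrib_left mult.left_commute cong: sum.cong)
qed

lemma matrix_inv_right: "invertible A \<Longrightarrow> A ** matrix_inv A = mat 1"
  and matrix_inv_left: "invertible A \<Longrightarrow> matrix_inv A ** A = mat 1"
  for A :: "'k::field^'n^'n"
  using someI_ex[of "\<lambda>A'. A ** A' = mat 1 \<and> A' ** A = mat 1"]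
  unfolding invertible_def matrix_inv_def by auto

lemma invertible_matrix_inv: "invertible A \<Longrightarrow> invertible (matrix_inv A)"
  for A :: "'k::field^'n^'n"
  using matrix_inv_left matrix_inv_right unfolding invertible_def by blast

lemma matrix_inv_matrix_inv: "invertible A \<Longrightarrow> matrix_inv (matrix_inv A) = A"
  for A :: "'k::field^'n^'n"
proof -
  assume inv: "invertible A"
  have "matrix_inv (matrix_inv A) = (A ** matrix_inv A) ** matrix_inv (matrix_inv A)"
    by (simp add: matrix_inv_right[OF inv])
  also have "\<dots> = A ** (matrix_inv A ** matrix_inv (matrix_inv A))"
    by (simp add: matrix_mul_assoc)
  also have "\<dots> = A"
    by (simp add: matrix_inv_right[OF invertible_matrix_inv[OF inv]])
  finally show ?thesis .
qed

lemma matrix_inv_in_normaliser: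
  fixes \<gamma> :: "'k::field^'n^'n"
  assumes "\<gamma> \<in> normaliser L"
  shows "matrix_inv \<gamma> \<in> normaliser L"
proof -
  have inv: "invertible \<gamma>" and conj: "(\<lambda>g. \<gamma> ** g ** matrix_inv \<gamma>) ` L = L"
    using assms unfolding normaliser_def by auto
  have "matrix_inv \<gamma> ** (\<gamma> ** g ** matrix_inv \<gamma>) ** \<gamma> = g" for g
  proof -
    have "matrix_inv \<gamma> ** (\<gamma> ** g ** matrix_inv \<gamma>) ** \<gamma>
        = (matrix_inv \<gamma> ** \<gamma>) ** g ** (matrix_inv \<gamma> ** \<gamma>)"
      by (simp add: matrix_mul_assoc)
    then show ?thesis
      by (simp add: matrix_inv_left[OF inv])
  qed
  then have "(\<lambda>g. matrix_inv \<gamma> ** g ** \<gamma>) ` (\<lambda>g. \<gamma> ** g ** matrix_inv \<gamma>) ` L = L"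
    by (simp add: image_image)
  then show ?thesis
    using conj inv unfolding normaliser_def
    by (simp add: invertible_matrix_inv matrix_inv_matrix_inv)
qed

lemma act_matrix_inv: "invertible \<gamma> \<Longrightarrow> act (matrix_inv \<gamma>) f = (\<lambda>x. f (\<gamma> *v x))"
  unfolding act_def by (simp add: matrix_inv_matrix_inv)

lemma subspaceK_zero: "subspaceK W \<Longrightarrow> (\<lambda>x. 0) \<in> W"
  unfolding subspaceK_def by blast

lemma subspaceK_lincomb:
  "subspaceK W \<Longrightarrow> f \<in> W \<Longrightarrow> g \<in> W \<Longrightarrow> (\<lambda>x. a * f x + b * g x) \<in> W"
  unfolding subspaceK_def by blast

lemma subspaceK_sum:
  assumes "subspaceK W" and "finite K" and "\<forall>k\<in>K. h k \<in> W"
  shows "(\<lambda>x. \<Sum>k\<in>K. c k * h k x) \<in> W"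
  using assms(2,3)
proof (induction K rule: finite_induct)
  case empty
  then show ?case
    using subspaceK_zero[OF assms(1)] by simp
next
  case (insert k K)
  then show ?case
    using subspaceK_lincomb[OF assms(1), of "h k" "\<lambda>x. \<Sum>k\<in>K. c k * h k x" "c k" 1] by simp
qed

lemma dualsp_lincomb:
  "\<phi> \<in> dualsp Es \<Longrightarrow> f \<in> Es \<Longrightarrow> g \<in> Es \<Longrightarrow> \<phi> (\<lambda>x. a * f x + b * g x) = a * \<phi> f + b * \<phi> g"
  unfolding dualsp_def by blast

lemma dualsp_sum:
  assumes "subspaceK Es" and "\<phi> \<in> dualsp Es" and "finite K" and "\<forall>k\<in>K. h k \<in> Es"
  shows "\<phi> (\<lambda>x. \<Sum>k\<in>K. c k * h k x) = (\<Sum>k\<in>K. c k * \<phi> (h k))"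
  using assms(3,4)
proof (induction K rule: finite_induct)
  case empty
  have "(\<lambda>x. 0) \<in> Es"
    using subspaceK_zero[OF assms(1)] .
  then show ?case
    using dualsp_lincomb[OF assms(2), of "\<lambda>x. 0" "\<lambda>x. 0" 0 0] by simp
next
  case (insert k K)
  then show ?case
    using dualsp_lincomb[OF assms(2), of "h k" "\<lambda>x. \<Sum>k\<in>K. c k * h k x" "c k" 1]
      subspaceK_sum[OF assms(1), of K h c] by simp
qed

lemma dualsp_eqI:
  assumes "subspaceK Es" and "Es \<subseteq> spanK A" and "A \<subseteq> Es"
    and "\<phi> \<in> dualsp Es" and "\<psi> \<in> dualsp Es" and "\<And>a. a \<in> A \<Longrightarrow> \<phi> a = \<psi> a"
  shows "\<phi> = \<psi>"
proof
  fix f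
  show "\<phi> f = \<psi> f"
  proof (cases "f \<in> Es")
    case True
    then obtain B c where B: "finite B" "B \<subseteq> A" and f: "f = (\<lambda>x. \<Sum>b\<in>B. c b * b x)"
      using assms(2) unfolding spanK_def by blast
    moreover have "\<forall>b\<in>B. b \<in> Es"
      using B(2) assms(3) by blast
    ultimately show ?thesis
      using dualsp_sum[OF assms(1,4) B(1), of "\<lambda>b. b" c]
        dualsp_sum[OF assms(1,5) B(1), of "\<lambda>b. b" c] assms(6)
      by (simp add: subset_iff)
  next
    case False
    then show ?thesis
      using assms(4,5) unfolding dualsp_def by simp
  qed
qed

lemma dualsp_scale: "\<phi> \<in> dualsp Es \<Longrightarrow> (\<lambda>f. c * \<phi> f) \<in> dualsp Es"
  unfolding dualsp_def by (simp add: algebra_simps)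

lemma dual_act_in_dualsp:
  assumes "subspaceK Es" and "\<forall>f\<in>Es. act (matrix_inv \<gamma>) f \<in> Es" and "\<phi> \<in> dualsp Es"
  shows "dual_act Es \<gamma> \<phi> \<in> dualsp Es"
proof -
  have "act (matrix_inv \<gamma>) (\<lambda>x. a * f x + b * g x)
      = (\<lambda>x. a * act (matrix_inv \<gamma>) f x + b * act (matrix_inv \<gamma>) g x)" for a b f g
    by (simp add: act_def)
  with assms show ?thesis
    unfolding dual_act_def by (auto simp: dualsp_def subspaceK_lincomb)
qed

lemma dual_basis_expansion:
  fixes s :: nat
  assumes "subspaceK Es" and "\<forall>j<s. Q j \<in> Es"
    and "\<forall>f\<in>Es. \<exists>c. f = (\<lambda>x. \<Sum>j<s. c j * Q j x)"
    and "\<forall>j<s. e j \<in> dualsp Es \<and> (\<forall>k<s. e j (Q k) = (if j = k then 1 else 0))"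
    and "g \<in> Es"
  shows "(\<Sum>j<s. Q j x * e j g) = g x"
proof -
  obtain c where c: "g = (\<lambda>x. \<Sum>k<s. c k * Q k x)"
    using assms(3,5) by blast
  have "e j g = c j" if "j < s" for j
  proof -
    have "e j g = (\<Sum>k<s. c k * e j (Q k))"
      unfolding c using assms(2,4) that by (intro dualsp_sum[OF assms(1)]) auto
    also have "\<dots> = c j"
      using assms(4) that by (simp add: if_distrib[of "(*) _"] cong: if_cong)
    finally show ?thesis .
  qed
  then show ?thesis
    by (simp add: c mult.commute)
qed

lemma dual_part_apply_homogeneous:
  assumes "\<forall>i\<le>D. w i \<in> dual_part Es i" and "(\<Sum>i\<le>D. w i b) = b v"
    and "b \<in> Es" and "b \<in> hom_polyfns d" and "i \<le> D"
  shows "w i b = (if i = d then b v else 0)"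
proof -
  have vanish: "w i' b = 0" if "i' \<le> D" "i' \<noteq> d" for i'
  proof -
    have "w i' \<in> dual_part Es i'"
      using assms(1) that(1) by blast
    then show ?thesis
      using assms(3,4) that(2) unfolding dual_part_def by auto
  qed
  show ?thesis
  proof (cases "i = d")
    case True
    have "b v = (\<Sum>i'\<le>D. w i' b)"
      using assms(2) by simp
    also have "\<dots> = (\<Sum>i'\<le>D. if i' = d then w d b else 0)"
      by (rule sum.cong) (auto simp: vanish)
    also have "\<dots> = w d b"
      using True assms(5) by simp
    finally show ?thesis
      using True by simp
  next
    case False
    then show ?thesis
      using vanish assms(5) by simp
  qed
qed

lemma dual_act_eigenvector:
  assumes "subspaceK Es" and "Es \<subseteq> spanK (\<Union>d. Es \<inter> hom_polyfns d)"
    and "invertible \<gamma>" and "\<forall>f\<in>Es. act (matrix_inv \<gamma>) f \<in> Es"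
    and "\<gamma> *v v = \<zeta> *s v" and "w \<in> dualsp Es"
    and "\<And>b d. b \<in> Es \<Longrightarrow> b \<in> hom_polyfns d \<Longrightarrow> w b = (if i = d then b v else 0)"
  shows "dual_act Es \<gamma> w = (\<lambda>f. \<zeta> ^ i * w f)"
proof (rule dualsp_eqI[OF assms(1,2)])
  show "(\<Union>d. Es \<inter> hom_polyfns d) \<subseteq> Es"
    by blast
  show "dual_act Es \<gamma> w \<in> dualsp Es"
    using dual_act_in_dualsp assms(1,4,6) .
  show "(\<lambda>f. \<zeta> ^ i * w f) \<in> dualsp Es"
    using dualsp_scale assms(6) .
  fix b
  assume "b \<in> (\<Union>d. Es \<inter> hom_polyfns d)"
  then obtain d where b: "b \<in> Es" "b \<in> hom_polyfns d"
    by blast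
  have "act (matrix_inv \<gamma>) b \<in> Es"
    using assms(4) b(1) by blast
  then have "(\<lambda>x. b (\<gamma> *v x)) \<in> Es"
    by (simp add: act_matrix_inv[OF assms(3)])
  then have "w (\<lambda>x. b (\<gamma> *v x)) = (if i = d then b (\<gamma> *v v) else 0)"
    by (rule assms(7)[OF _ hom_polyfns_compose_matrix[OF b(2)]])
  then have "dual_act Es \<gamma> w b = (if i = d then b (\<gamma> *v v) else 0)"
    using b(1) by (simp add: dual_act_def act_matrix_inv[OF assms(3)])
  also have "\<dots> = (if i = d then \<zeta> ^ d * b v else 0)"
    using assms(5) hom_polyfns_scale[OF b(2)] by simp
  also have "\<dots> = \<zeta> ^ i * w b"
    using assms(7)[OF b] by simp
  finally show "dual_act Es \<gamma> w b = \<zeta> ^ i * w b" .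
qed

theorem proposition8p9:
  fixes G L :: "('k::field_char_0 ^ 'n::finite ^ 'n) set"
    and Es :: "('k ^ 'n \<Rightarrow> 'k) set"
    and s :: nat and Q :: "nat \<Rightarrow> ('k ^ 'n \<Rightarrow> 'k)"
    and e :: "nat \<Rightarrow> (('k ^ 'n \<Rightarrow> 'k) \<Rightarrow> 'k)"
    and D :: nat and w :: "nat \<Rightarrow> (('k ^ 'n \<Rightarrow> 'k) \<Rightarrow> 'k)"
    and \<gamma> :: "'k ^ 'n ^ 'n" and v :: "'k ^ 'n" and \<zeta> :: 'k
  assumes "alg_closed_field TYPE('k)"
    and "reflection_group G"
    and "normal_subgroup L G"
    and "graded_complement L Es"
    and "\<forall>\<delta>\<in>normaliser L. \<forall>f\<in>Es. act \<delta> f \<in> Es"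
    and "\<forall>j<s. Q j \<in> Es \<and> (\<exists>d. Q j \<in> hom_polyfns d)"
    and "\<forall>c. (\<lambda>x. \<Sum>j<s. c j * Q j x) = (\<lambda>x. 0) \<longrightarrow> (\<forall>j<s. c j = 0)"
    and "\<forall>f\<in>Es. \<exists>c. f = (\<lambda>x. \<Sum>j<s. c j * Q j x)"
    and "\<forall>j<s. e j \<in> dualsp Es \<and> (\<forall>k<s. e j (Q k) = (if j = k then 1 else 0))"
    and "quotient_acts_as_reflection_group G Es"
    and "\<gamma> \<in> normaliser G \<inter> normaliser L"
    and "semisimple \<gamma>"
    and "\<zeta> \<noteq> 0"
    and "\<gamma> *v v = \<zeta> *s v"
    and "\<forall>i\<le>D. w i \<in> dual_part Es i"
    and "(\<lambda>f. \<Sum>j<s. Q j v * e j f) = (\<lambda>f. \<Sum>i\<le>D. w i f)"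
  shows "\<forall>i\<le>D. dual_act Es \<gamma> (w i) = (\<lambda>f. \<zeta> ^ i * w i f)"
proof -
  have sub: "subspaceK Es" and graded: "Es \<subseteq> spanK (\<Union>d. Es \<inter> hom_polyfns d)"
    using assms(4) unfolding graded_complement_def by auto
  have \<gamma>L: "\<gamma> \<in> normaliser L"
    using assms(11) by blast
  then have inv: "invertible \<gamma>"
    unfolding normaliser_def by blast
  have stable: "\<forall>f\<in>Es. act (matrix_inv \<gamma>) f \<in> Es"
    using assms(5) matrix_inv_in_normaliser[OF \<gamma>L] by blast
  have expansion: "(\<Sum>i\<le>D. w i g) = g v" if "g \<in> Es" for g
  proof -
    have "(\<Sum>j<s. Q j v * e j g) = g v"
      using assms(6) by (intro dual_basis_expansion[OF sub _ assms(8,9) that]) blast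
    then show ?thesis
      using fun_cong[OF assms(16), of g] by simp
  qed
  show ?thesis
  proof (intro allI impI)
    fix i
    assume "i \<le> D"
    show "dual_act Es \<gamma> (w i) = (\<lambda>f. \<zeta> ^ i * w i f)"
    proof (rule dual_act_eigenvector[OF sub graded inv stable assms(14)])
      show "w i \<in> dualsp Es"
        using assms(15) \<open>i \<le> D\<close> unfolding dual_part_def by blast
      show "w i b = (if i = d then b v else 0)" if "b \<in> Es" "b \<in> hom_polyfns d" for b d
        using dual_part_apply_homogeneous[OF assms(15) expansion that \<open>i \<le> D\<close>] that(1) .
    qed
  qed
qed

end
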